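(* Let $r>1$ be an irrational number and $P_r=\{\lfloor nr\rfloor : n\in\mathbb{Z}\setminus\{0\}\}$. For each integer $m\geq 1$ let $D_{m,+}^{\mathbb{Z}}=\{x\in\mathbb{Z}: x=my \text{ for some } y\in P_r\}$ and $D_{m,-}^{\mathbb{Z}}=\{x\in\mathbb{Z}: x=my\text{ for some }y\in\mathbb{Z}\setminus P_r\}$. Then the structure $\big(\mathbb{Z},+,-,0,1,(D_{m,+}^{\mathbb{Z}})_{m\geq1},(D_{m,-}^{\mathbb{Z}})_{m\geq1}\big)$, in the language $L_\pm=\{+,-,0,1\}\cup\{D_{m,+},D_{m,-}: m\geq 1\}$ (with $D_{m,\pm}$ unary predicate symbols), has quantifier elimination.
   Context: Note $D_{1,+}^{\mathbb{Z}}=P_r$ and $D_{m,+}^{\mathbb{Z}}\cup D_{m,-}^{\mathbb{Z}}=m\mathbb{Z}$. *)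

theory Defs
  imports Complex_Main
begin

section \<open>The language\<close>

datatype lpm_term =
    Var nat
  | Zero
  | One
  | Add lpm_term lpm_term
  | Minus lpm_term

text \<open>
  The constructors \<open>DPlus k\<close> and \<open>DMinus k\<close> stand for the predicate symbols \<open>D\<^bsub>m,+\<^esub>\<close> and
  \<open>D\<^bsub>m,-\<^esub>\<close> with \<open>m = k + 1\<close>, so that exactly the indices \<open>m \<ge> 1\<close> occur.
\<close>

datatype lpm_formula =
    Eq lpm_term lpm_term
  | DPlus nat lpm_term
  | DMinus nat lpm_term
  | Neg lpm_formula
  | Conj lpm_formula lpm_formula
  | Disj lpm_formula lpm_formula
  | Ex nat lpm_formula
  | All nat lpm_formula

primrec term_vars :: "lpm_term \<Rightarrow> nat set" where
  "term_vars (Var x) = {x}"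
| "term_vars Zero = {}"
| "term_vars One = {}"
| "term_vars (Add s t) = term_vars s \<union> term_vars t"
| "term_vars (Minus t) = term_vars t"

primrec free_vars :: "lpm_formula \<Rightarrow> nat set" where
  "free_vars (Eq s t) = term_vars s \<union> term_vars t"
| "free_vars (DPlus k t) = term_vars t"
| "free_vars (DMinus k t) = term_vars t"
| "free_vars (Neg \<phi>) = free_vars \<phi>"
| "free_vars (Conj \<phi> \<psi>) = free_vars \<phi> \<union> free_vars \<psi>"
| "free_vars (Disj \<phi> \<psi>) = free_vars \<phi> \<union> free_vars \<psi>"
| "free_vars (Ex x \<phi>) = free_vars \<phi> - {x}"
| "free_vars (All x \<phi>) = free_vars \<phi> - {x}"

primrec quantifier_free :: "lpm_formula \<Rightarrow> bool" where
  "quantifier_free (Eq s t) \<longleftrightarrow> True"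
| "quantifier_free (DPlus k t) \<longleftrightarrow> True"
| "quantifier_free (DMinus k t) \<longleftrightarrow> True"
| "quantifier_free (Neg \<phi>) \<longleftrightarrow> quantifier_free \<phi>"
| "quantifier_free (Conj \<phi> \<psi>) \<longleftrightarrow> quantifier_free \<phi> \<and> quantifier_free \<psi>"
| "quantifier_free (Disj \<phi> \<psi>) \<longleftrightarrow> quantifier_free \<phi> \<and> quantifier_free \<psi>"
| "quantifier_free (Ex x \<phi>) \<longleftrightarrow> False"
| "quantifier_free (All x \<phi>) \<longleftrightarrow> False"

section \<open>Structures and quantifier elimination\<close>

text \<open>
  The universe of a structure is the whole type \<open>'a\<close>. The fields \<open>DP\<close> and \<open>DM\<close> are indexed by the
  actual \<open>m\<close>; their values at \<open>0\<close> interpret no symbol.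
\<close>

record 'a lpm_structure =
  zero_of :: 'a
  one_of :: 'a
  add_of :: "'a \<Rightarrow> 'a \<Rightarrow> 'a"
  minus_of :: "'a \<Rightarrow> 'a"
  DP :: "nat \<Rightarrow> 'a set"
  DM :: "nat \<Rightarrow> 'a set"

primrec term_value :: "'a lpm_structure \<Rightarrow> (nat \<Rightarrow> 'a) \<Rightarrow> lpm_term \<Rightarrow> 'a" where
  "term_value M e (Var x) = e x"
| "term_value M e Zero = zero_of M"
| "term_value M e One = one_of M"
| "term_value M e (Add s t) = add_of M (term_value M e s) (term_value M e t)"
| "term_value M e (Minus t) = minus_of M (term_value M e t)"

primrec satisfies :: "'a lpm_structure \<Rightarrow> (nat \<Rightarrow> 'a) \<Rightarrow> lpm_formula \<Rightarrow> bool" where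
  "satisfies M e (Eq s t) \<longleftrightarrow> term_value M e s = term_value M e t"
| "satisfies M e (DPlus k t) \<longleftrightarrow> term_value M e t \<in> DP M (k + 1)"
| "satisfies M e (DMinus k t) \<longleftrightarrow> term_value M e t \<in> DM M (k + 1)"
| "satisfies M e (Neg \<phi>) \<longleftrightarrow> \<not> satisfies M e \<phi>"
| "satisfies M e (Conj \<phi> \<psi>) \<longleftrightarrow> satisfies M e \<phi> \<and> satisfies M e \<psi>"
| "satisfies M e (Disj \<phi> \<psi>) \<longleftrightarrow> satisfies M e \<phi> \<or> satisfies M e \<psi>"
| "satisfies M e (Ex x \<phi>) \<longleftrightarrow> (\<exists>a. satisfies M (e(x := a)) \<phi>)"
| "satisfies M e (All x \<phi>) \<longleftrightarrow> (\<forall>a. satisfies M (e(x := a)) \<phi>)"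

definition has_quantifier_elimination :: "'a lpm_structure \<Rightarrow> bool" where
  "has_quantifier_elimination M \<longleftrightarrow>
     (\<forall>\<phi>. \<exists>\<psi>. quantifier_free \<psi> \<and> free_vars \<psi> \<subseteq> free_vars \<phi> \<and>
        (\<forall>e. satisfies M e \<phi> \<longleftrightarrow> satisfies M e \<psi>))"

section \<open>The structure on the integers given by a Beatty sequence\<close>

definition beatty_set :: "real \<Rightarrow> int set" where
  "beatty_set r = {\<lfloor>of_int n * r\<rfloor> | n :: int. n \<noteq> 0}"

definition D_plus :: "real \<Rightarrow> nat \<Rightarrow> int set" where
  "D_plus r m = {x. \<exists>y \<in> beatty_set r. x = int m * y}"

definition D_minus :: "real \<Rightarrow> nat \<Rightarrow> int set" where
  "D_minus r m = {x. \<exists>y \<in> - beatty_set r. x = int m * y}"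

definition beatty_structure :: "real \<Rightarrow> int lpm_structure" where
  "beatty_structure r =
     \<lparr>zero_of = 0, one_of = 1, add_of = (+), minus_of = uminus, DP = D_plus r, DM = D_minus r\<rparr>"

end

theory Submission
  imports Defs "HOL-Analysis.Kronecker_Approximation_Theorem"
begin

text \<open>
  Put \<open>\<alpha> = 1 / r\<close>. Then \<open>y \<in> P\<^sub>r\<close> iff the fractional part \<open>fr y\<close> of \<open>\<alpha> y\<close> exceeds \<open>1 - \<alpha>\<close>, and
  counting elements of \<open>P\<^sub>r\<close> in \<open>y, \<dots>, y + n - 1\<close> defines every interval \<open>{y. fr y < fr (- n)}\<close>
  without quantifiers. These intervals approximate \<open>fr\<close> to any precision, so the sign of a
  combination \<open>\<Sum> a\<^sub>i fr (s\<^sub>i) + b + c \<alpha>\<close> is definable: it is read off an approximation unless it is close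
  to \<open>0\<close>, and then it is given by \<open>fr (\<Sum> a\<^sub>i s\<^sub>i + c)\<close>.
  To eliminate \<open>\<exists>x\<close>, split \<open>x\<close> into residue classes, so that the atoms become \<open>k a + s \<in> P\<^sub>r\<close> and
  \<open>k a + s = 0\<close>. The solutions of finitely many equations \<open>k a + s = 0\<close> are substituted directly. For
  all other \<open>a\<close> the atoms place \<open>fr a\<close> in open intervals whose endpoints are rational multiples of
  combinations as above; by Kronecker's density theorem a suitable \<open>a\<close> exists iff every lower
  bound is less than every upper bound.
\<close>

section \<open>Fractional parts of multiples of \<open>alpha\<close> and membership in the Beatty
  set\<close>

locale irrational_slope =
  fixes r :: real
  assumes r_gt_1: "r > 1" and r_irrational: "r \<notin> \<rat>"
begin

definition alpha :: real where "alpha = 1 / r"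

definition fr :: "int \<Rightarrow> real" where "fr y = frac (alpha * of_int y)"

lemma alpha_pos: "0 < alpha" and alpha_less_1: "alpha < 1"
  using r_gt_1 by (auto simp: alpha_def)

lemma alpha_irrational: "alpha \<notin> \<rat>"
proof
  assume "alpha \<in> \<rat>"
  then have "1 / alpha \<in> \<rat>" by (rule Rats_divide[OF Rats_1])
  then show False using r_irrational by (simp add: alpha_def)
qed

lemma alpha_mult_in_Ints_iff: "alpha * of_int y \<in> \<int> \<longleftrightarrow> y = 0"
proof
  assume "alpha * of_int y \<in> \<int>"
  then have "alpha * of_int y \<in> \<rat>" using Ints_subset_Rats by blast
  then have "alpha * of_int y / of_int y \<in> \<rat>" by (rule Rats_divide[OF _ Rats_of_int])
  then show "y = 0" using alpha_irrational by (cases "y = 0") auto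
qed simp

lemma fr_bounds: "0 \<le> fr y" "fr y < 1"
  by (auto simp: fr_def frac_lt_1)

lemma fr_diff_in_Ints: "alpha * of_int y - fr y \<in> \<int>"
  by (simp add: fr_def frac_def)

lemma fr_eqI: "0 \<le> x \<Longrightarrow> x < 1 \<Longrightarrow> alpha * of_int y - x \<in> \<int> \<Longrightarrow> fr y = x"
  unfolding fr_def by (subst frac_unique_iff) auto

text \<open>Equal fractional parts make \<open>alpha * (x - y)\<close> an integer, which
  irrationality permits only for \<open>x = y\<close>.\<close>

lemma fr_inj: "fr x = fr y \<longleftrightarrow> x = y"
proof
  assume "fr x = fr y"
  then have "alpha * of_int (x - y) \<in> \<int>"
    using Ints_diff[OF fr_diff_in_Ints[of x] fr_diff_in_Ints[of y]] by (simp add: algebra_simps)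
  then show "x = y" using alpha_mult_in_Ints_iff[of "x - y"] by simp
qed simp

lemma fr_0: "fr 0 = 0" and fr_minus_1: "fr (- 1) = 1 - alpha"
  using alpha_pos alpha_less_1 by (auto intro!: fr_eqI)

text \<open>Division by \<open>r\<close> places the integer \<open>n\<close> in
  \<open>[alpha * y, alpha * y + alpha)\<close>. The left end is an integer only for
  \<open>y = 0\<close>, which would force \<open>n = 0\<close>; so \<open>n\<close> lies above
  \<open>alpha * y\<close> by less than \<open>alpha < 1\<close>.\<close>

lemma beatty_set_iff: "y \<in> beatty_set r \<longleftrightarrow> 1 - alpha < fr y"
proof -
  have *: "y = \<lfloor>of_int n * r\<rfloor> \<longleftrightarrow> alpha * of_int y \<le> of_int n \<and> of_int n < alpha * of_int y + alpha" for n
  proof -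
    have "y = \<lfloor>of_int n * r\<rfloor> \<longleftrightarrow> of_int y \<le> of_int n * r \<and> of_int n * r < of_int y + 1"
      by (metis floor_eq_iff)
    also have "\<dots> \<longleftrightarrow> alpha * of_int y \<le> of_int n \<and> of_int n < alpha * of_int y + alpha"
      using r_gt_1 unfolding alpha_def by (auto simp: field_simps)
    finally show ?thesis .
  qed
  show ?thesis
  proof
    assume "y \<in> beatty_set r"
    then obtain n where n: "n \<noteq> 0" "y = \<lfloor>of_int n * r\<rfloor>" by (auto simp: beatty_set_def)
    with * have b: "alpha * of_int y \<le> of_int n" "of_int n < alpha * of_int y + alpha" by auto
    have "alpha * of_int y \<noteq> of_int n"
    proof
      assume "alpha * of_int y = of_int n"
      then have "alpha * of_int y \<in> \<int>" by simp
      then have "y = 0" by (simp add: alpha_mult_in_Ints_iff)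
      with \<open>alpha * of_int y = of_int n\<close> n show False by simp
    qed
    then have "fr y = alpha * of_int y - of_int n + 1"
      using b alpha_less_1 by (intro fr_eqI) auto
    then show "1 - alpha < fr y" using b by simp
  next
    assume a: "1 - alpha < fr y"
    \<comment> \<open>The least integer above \<open>alpha * y\<close>; the assumption puts it at
      distance less than \<open>alpha\<close>.\<close>
    define n where "n = \<lfloor>alpha * of_int y\<rfloor> + 1"
    have fy: "fr y = alpha * of_int y - of_int n + 1" by (simp add: fr_def frac_def n_def)
    have "y = \<lfloor>of_int n * r\<rfloor>"
      unfolding * using a fy fr_bounds[of y] by linarith
    moreover have "n \<noteq> 0"
    proof
      assume "n = 0"
      with \<open>y = \<lfloor>of_int n * r\<rfloor>\<close> have "y = 0" by simp
      with \<open>n = 0\<close> show False by (simp add: n_def)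
    qed
    ultimately show "y \<in> beatty_set r" by (auto simp: beatty_set_def)
  qed
qed

section \<open>Density of the fractional parts\<close>

text \<open>Kronecker's theorem for \<open>- alpha\<close>, aimed at the midpoint of the interval.
  Arguments \<open>- int n\<close> are chosen because counting elements of the Beatty set makes the
  cuts at \<open>fr (- int n)\<close> definable.\<close>

lemma fr_dense_neg:
  assumes "0 \<le> u" "u < v" "v \<le> 1"
  obtains n :: nat where "n > 0" "u < fr (- int n)" "fr (- int n) < v"
proof -
  have "- alpha \<notin> \<rat>" using alpha_irrational by simp
  then obtain k :: nat where k: "k > 0" "\<bar>frac (real k * (- alpha)) - (u + v) / 2\<bar> < (v - u) / 2"
    using assms by (elim Kronecker_approx_1_explicit[where \<alpha> = "(u + v) / 2" and \<epsilon> = "(v - u) / 2"]) auto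
  then have "u < fr (- int k)" "fr (- int k) < v"
    by (auto simp: fr_def mult.commute abs_less_iff field_simps)
  with k that show thesis by blast
qed

text \<open>Values of \<open>fr\<close> on \<open>X\<close> are avoided by shrinking the interval:
  its upper end becomes the least of \<open>v\<close> and the values on \<open>X\<close> that exceed
  \<open>u\<close>.\<close>

lemma fr_dense_avoiding:
  assumes "0 \<le> u" "u < v" "v \<le> 1" "finite X"
  obtains a where "a \<notin> X" "u < fr a" "fr a < v"
proof -
  define w where "w = Min (insert v (fr ` {x \<in> X. u < fr x}))"
  have fin: "finite (insert v (fr ` {x \<in> X. u < fr x}))" using assms by simp
  have "u < w" using assms fin by (auto simp: w_def)
  moreover have "w \<le> v" using fin by (simp add: w_def)
  ultimately obtain n where n: "u < fr (- int n)" "fr (- int n) < w"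
    using assms by (elim fr_dense_neg[of u w]) auto
  have "- int n \<notin> X"
  proof
    assume "- int n \<in> X"
    then have "w \<le> fr (- int n)" unfolding w_def using fin n by (intro Min_le) auto
    with n show False by simp
  qed
  with n \<open>w \<le> v\<close> that show thesis by fastforce
qed

section \<open>Comparing fractional parts by counting\<close>

text \<open>The floor of \<open>alpha * y\<close> jumps between \<open>y\<close> and \<open>y + 1\<close> exactly when \<open>fr y \<ge> 1 - alpha\<close>;
  counting the jumps up to \<open>y + n\<close> compares \<open>fr y\<close> with \<open>fr (- n)\<close>.\<close>

lemma floor_eq_add_card:
  "\<lfloor>alpha * of_int (y + int n)\<rfloor> =
     \<lfloor>alpha * of_int y\<rfloor> + int (card {i \<in> {..<n}. y + int i \<in> beatty_set r \<or> y + int i = - 1})"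
proof (induction n)
  case (Suc n)
  define z where "z = y + int n"
  have "\<lfloor>alpha * of_int (z + 1)\<rfloor> = \<lfloor>alpha * of_int z\<rfloor> + (if z \<in> beatty_set r \<or> z = - 1 then 1 else 0)"
  proof -
    \<comment> \<open>The point \<open>- 1\<close> has fractional part exactly
      \<open>1 - alpha\<close>: it is a jump outside the Beatty set and is therefore listed
      separately.\<close>
    have "z \<in> beatty_set r \<or> z = - 1 \<longleftrightarrow> 1 - alpha \<le> fr z"
      using fr_inj[of z "- 1"] by (auto simp: beatty_set_iff fr_minus_1)
    moreover have "alpha * of_int (z + 1) = of_int \<lfloor>alpha * of_int z\<rfloor> + (fr z + alpha)"
      by (simp add: fr_def frac_def algebra_simps)
    then have "\<lfloor>alpha * of_int (z + 1)\<rfloor> = \<lfloor>alpha * of_int z\<rfloor> + \<lfloor>fr z + alpha\<rfloor>"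
      by (metis floor_add_int add.commute)
    moreover have "\<lfloor>fr z + alpha\<rfloor> = (if 1 - alpha \<le> fr z then 1 else 0)"
      using fr_bounds[of z] alpha_pos alpha_less_1 by (auto simp: floor_eq_iff)
    ultimately show ?thesis by simp
  qed
  moreover have "{i \<in> {..<Suc n}. y + int i \<in> beatty_set r \<or> y + int i = - 1} =
    (if z \<in> beatty_set r \<or> z = - 1 then insert n else id) {i \<in> {..<n}. y + int i \<in> beatty_set r \<or> y + int i = - 1}"
    by (auto simp: z_def less_Suc_eq)
  ultimately show ?case using Suc.IH by (auto simp: z_def algebra_simps)
qed simp

text \<open>With \<open>q\<close> the floor of \<open>alpha * n\<close>, the number of jumps is
  \<open>q\<close> or \<open>q + 1\<close>, the latter iff adding \<open>fr y\<close> and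
  \<open>fr n\<close> carries, that is, iff \<open>fr y \<ge> 1 - fr n = fr (- n)\<close>. Having at
  least \<open>q + 1\<close> jumps is a finite disjunction over index sets \<open>U\<close>, hence
  needs no quantifier.\<close>

lemma fr_less_neg_iff:
  assumes "n > 0"
  shows "fr y < fr (- int n) \<longleftrightarrow>
    \<not> (\<exists>U \<in> {U \<in> Pow {..<n}. int (card U) = \<lfloor>alpha * of_int (int n)\<rfloor> + 1}.
         \<forall>i\<in>U. y + int i \<in> beatty_set r \<or> y + int i = - 1)"
proof -
  define A where "A = {i \<in> {..<n}. y + int i \<in> beatty_set r \<or> y + int i = - 1}"
  define q where "q = \<lfloor>alpha * of_int (int n)\<rfloor>"
  have q0: "q \<ge> 0" using alpha_pos by (simp add: q_def)
  have nz: "fr (int n) \<noteq> 0" using fr_inj[of "int n" 0] assms by (simp add: fr_0)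
  have neg: "fr (- int n) = 1 - fr (int n)"
    using fr_bounds[of "int n"] nz
    by (intro fr_eqI) (auto simp: fr_def frac_def less_le)
  have "int (card A) = \<lfloor>alpha * of_int (y + int n)\<rfloor> - \<lfloor>alpha * of_int y\<rfloor>"
    using floor_eq_add_card[of y n] by (simp add: A_def)
  also have "\<dots> = q + (if fr y + fr (int n) \<ge> 1 then 1 else 0)"
  proof -
    have "alpha * of_int (y + int n) =
        of_int (\<lfloor>alpha * of_int y\<rfloor> + q) + (fr y + fr (int n))"
      by (simp add: fr_def frac_def q_def algebra_simps)
    then have "\<lfloor>alpha * of_int (y + int n)\<rfloor> =
        \<lfloor>alpha * of_int y\<rfloor> + q + \<lfloor>fr y + fr (int n)\<rfloor>"
      by (metis floor_add_int add.commute)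
    moreover have "\<lfloor>fr y + fr (int n)\<rfloor> = (if fr y + fr (int n) \<ge> 1 then 1 else 0)"
      using fr_bounds[of y] fr_bounds[of "int n"] by (auto simp: floor_eq_iff)
    ultimately show ?thesis by simp
  qed
  finally have "fr y < fr (- int n) \<longleftrightarrow> \<not> q + 1 \<le> int (card A)" by (auto simp: neg)
  also have "q + 1 \<le> int (card A) \<longleftrightarrow> (\<exists>U\<subseteq>A. int (card U) = q + 1)"
  proof
    assume "q + 1 \<le> int (card A)"
    then have "nat (q + 1) \<le> card A" by linarith
    then obtain U where "U \<subseteq> A" "card U = nat (q + 1)" by (meson obtain_subset_with_card_n)
    then show "\<exists>U\<subseteq>A. int (card U) = q + 1" using q0 by auto
  next
    assume "\<exists>U\<subseteq>A. int (card U) = q + 1"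
    moreover have "finite A" by (simp add: A_def)
    ultimately show "q + 1 \<le> int (card A)" by (metis card_mono of_nat_le_iff)
  qed
  also have "(\<exists>U\<subseteq>A. int (card U) = q + 1) \<longleftrightarrow>
    (\<exists>U \<in> {U \<in> Pow {..<n}. int (card U) = q + 1}. \<forall>i\<in>U. y + int i \<in> beatty_set r \<or> y + int i = - 1)"
    unfolding A_def by blast
  finally show ?thesis by (simp add: q_def)
qed

subsection \<open>Quantifier-free definability\<close>

abbreviation "M \<equiv> beatty_structure r"

text \<open>Terms and quantifier-free formulas are treated through the functions and predicates of
  the assignment that they denote, so that closure properties replace work on syntax.\<close>

definition lin :: "nat set \<Rightarrow> ((nat \<Rightarrow> int) \<Rightarrow> int) \<Rightarrow> bool" where
  "lin V t \<longleftrightarrow> (\<exists>u. term_vars u \<subseteq> V \<and> (\<forall>e. t e = term_value M e u))"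

definition definable :: "nat set \<Rightarrow> ((nat \<Rightarrow> int) \<Rightarrow> bool) \<Rightarrow> bool" where
  "definable V S \<longleftrightarrow> (\<exists>\<psi>. quantifier_free \<psi> \<and> free_vars \<psi> \<subseteq> V \<and> (\<forall>e. S e \<longleftrightarrow> satisfies M e \<psi>))"

lemma structure_simps [simp]:
  "zero_of M = 0" "one_of M = 1" "add_of M = (+)" "minus_of M = uminus"
  "DP M = D_plus r" "DM M = D_minus r"
  by (simp_all add: beatty_structure_def)

lemma lin_term: "term_vars u \<subseteq> V \<Longrightarrow> lin V (\<lambda>e. term_value M e u)"
  by (auto simp: lin_def)

lemma lin_add: "lin V s \<Longrightarrow> lin V t \<Longrightarrow> lin V (\<lambda>e. s e + t e)"
  unfolding lin_def by (elim exE, rule_tac x = "Add u ua" in exI) auto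

lemma lin_minus: "lin V s \<Longrightarrow> lin V (\<lambda>e. - s e)"
  unfolding lin_def by (elim exE, rule_tac x = "Minus u" in exI) auto

lemma lin_mult: "lin V s \<Longrightarrow> lin V (\<lambda>e. k * s e)"
proof (induction k rule: int_induct[where k = 0])
  case base
  show ?case using lin_term[of Zero V] by simp
next
  case (step1 i)
  then show ?case using lin_add[of V "\<lambda>e. i * s e" s] by (simp add: algebra_simps)
next
  case (step2 i)
  then show ?case using lin_add[OF _ lin_minus, of V "\<lambda>e. i * s e" s] by (simp add: algebra_simps)
qed

lemma lin_const: "lin V (\<lambda>_. k)"
  using lin_mult[of V "\<lambda>_. 1" k] lin_term[of lpm_term.One V] by simp

lemma definable_formula: "quantifier_free \<psi> \<Longrightarrow> free_vars \<psi> \<subseteq> V \<Longrightarrow> definable V (\<lambda>e. satisfies M e \<psi>)"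
  by (auto simp: definable_def)

lemma definable_not: "definable V S \<Longrightarrow> definable V (\<lambda>e. \<not> S e)"
  unfolding definable_def by (elim exE, rule_tac x = "Neg \<psi>" in exI) auto

lemma definable_or: "definable V S \<Longrightarrow> definable V T \<Longrightarrow> definable V (\<lambda>e. S e \<or> T e)"
  unfolding definable_def by (elim exE, rule_tac x = "Disj \<psi> \<psi>'" in exI) auto

lemma definable_and: "definable V S \<Longrightarrow> definable V T \<Longrightarrow> definable V (\<lambda>e. S e \<and> T e)"
  using definable_not[OF definable_or[OF definable_not definable_not, of V S T]] by simp

lemma definable_const: "definable V (\<lambda>_. b)"
  using definable_formula[of "Eq Zero Zero" V] definable_not[OF definable_formula[of "Eq Zero Zero" V]] by (cases b) auto

lemma definable_bex: "finite I \<Longrightarrow> (\<And>i. i \<in> I \<Longrightarrow> definable V (S i)) \<Longrightarrow> definable V (\<lambda>e. \<exists>i\<in>I. S i e)"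
  by (induction I rule: finite_induct) (simp_all add: definable_const definable_or)

lemma definable_ball:
  assumes "finite I" "\<And>i. i \<in> I \<Longrightarrow> definable V (S i)"
  shows "definable V (\<lambda>e. \<forall>i\<in>I. S i e)"
proof -
  have "definable V (\<lambda>e. \<not> (\<exists>i\<in>I. \<not> S i e))" using assms by (intro definable_not definable_bex)
  then show ?thesis by simp
qed

lemma definable_imp: "definable V S \<Longrightarrow> definable V T \<Longrightarrow> definable V (\<lambda>e. S e \<longrightarrow> T e)"
  unfolding imp_conv_disj by (intro definable_or definable_not)

lemma definable_lin_eq_0: "lin V t \<Longrightarrow> definable V (\<lambda>e. t e = 0)"
  unfolding lin_def definable_def by (elim exE, rule_tac x = "Eq u Zero" in exI) auto

lemma definable_lin_D_plus:
  assumes "lin V t" "m > 0"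
  shows "definable V (\<lambda>e. t e \<in> D_plus r m)"
proof -
  obtain u where "term_vars u \<subseteq> V" "\<And>e. t e = term_value M e u"
    using assms by (auto simp: lin_def)
  then show ?thesis using assms unfolding definable_def by (intro exI[of _ "DPlus (m - 1) u"]) auto
qed

lemma definable_lin_D_minus:
  assumes "lin V t" "m > 0"
  shows "definable V (\<lambda>e. t e \<in> D_minus r m)"
proof -
  obtain u where "term_vars u \<subseteq> V" "\<And>e. t e = term_value M e u"
    using assms by (auto simp: lin_def)
  then show ?thesis using assms unfolding definable_def by (intro exI[of _ "DMinus (m - 1) u"]) auto
qed

lemma D_plus_iff: "k > 0 \<Longrightarrow> z \<in> D_plus r k \<longleftrightarrow> int k dvd z \<and> z div int k \<in> beatty_set r"
  and D_minus_iff: "k > 0 \<Longrightarrow> z \<in> D_minus r k \<longleftrightarrow> int k dvd z \<and> z div int k \<notin> beatty_set r"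
  by (auto simp: D_plus_def D_minus_def)

text \<open>Each multiple of \<open>m\<close> is \<open>m * y\<close> with \<open>y\<close> inside
  or outside the Beatty set, so the two predicates for \<open>m\<close> together express
  divisibility.\<close>

lemma definable_lin_dvd:
  assumes "lin V t" "m > 0"
  shows "definable V (\<lambda>e. m dvd t e)"
proof -
  have "m dvd z \<longleftrightarrow> z \<in> D_plus r (nat m) \<or> z \<in> D_minus r (nat m)" for z
    using assms(2) by (auto simp: D_plus_iff D_minus_iff)
  then show ?thesis
    using definable_or[OF definable_lin_D_plus definable_lin_D_minus, of V t "nat m" t "nat m"] assms by simp
qed

section \<open>Piecewise linear functions\<close>

text \<open>The piecewise form makes the class closed under division with remainder.\<close>

definition pw_linear :: "nat set \<Rightarrow> ((nat \<Rightarrow> int) \<Rightarrow> int) \<Rightarrow> bool" where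
  "pw_linear V s \<longleftrightarrow> (\<exists>N>0. \<exists>F. finite F \<and>
     (\<forall>(R, t)\<in>F. definable V R \<and> lin V t \<and> (\<forall>e. R e \<longrightarrow> N * s e = t e)) \<and> (\<forall>e. \<exists>(R, t)\<in>F. R e))"

lemma pw_linear_lin: "lin V t \<Longrightarrow> pw_linear V t"
  unfolding pw_linear_def
  by (intro exI[of _ 1] conjI exI[of _ "{(\<lambda>_. True, t)}"]) (auto intro: definable_const)

lemma pw_linear_const: "pw_linear V (\<lambda>_. k)"
  by (intro pw_linear_lin lin_const)

text \<open>Pieces are intersected pairwise, and both equations are brought to the denominator
  \<open>N * N'\<close>.\<close>

lemma pw_linear_add:
  assumes "pw_linear V s" "pw_linear V s'"
  shows "pw_linear V (\<lambda>e. s e + s' e)"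
proof -
  obtain N F where 1: "N > 0" "finite F" "\<And>e. \<exists>(R, t)\<in>F. R e"
    "\<And>R t. (R, t) \<in> F \<Longrightarrow> definable V R \<and> lin V t \<and> (\<forall>e. R e \<longrightarrow> N * s e = t e)"
    using assms(1) unfolding pw_linear_def by blast
  obtain N' F' where 2: "N' > 0" "finite F'" "\<And>e. \<exists>(R, t)\<in>F'. R e"
    "\<And>R t. (R, t) \<in> F' \<Longrightarrow> definable V R \<and> lin V t \<and> (\<forall>e. R e \<longrightarrow> N' * s' e = t e)"
    using assms(2) unfolding pw_linear_def by blast
  let ?c = "\<lambda>((R, t), (R', t')). (\<lambda>e. R e \<and> R' e, \<lambda>e. N' * t e + N * t' e)"
  show ?thesis unfolding pw_linear_def
  proof (intro exI conjI)
    show "N * N' > 0" using 1 2 by simp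
    show "finite (?c ` (F \<times> F'))" using 1 2 by simp
    show "\<forall>(R, t)\<in>?c ` (F \<times> F'). definable V R \<and> lin V t \<and> (\<forall>e. R e \<longrightarrow> N * N' * (s e + s' e) = t e)"
    proof (clarsimp, intro conjI allI impI)
      fix R t R' t' assume a: "(R, t) \<in> F" "(R', t') \<in> F'"
      show "definable V (\<lambda>e. R e \<and> R' e)" "lin V (\<lambda>e. N' * t e + N * t' e)"
        using 1(4)[OF a(1)] 2(4)[OF a(2)] by (auto intro!: definable_and lin_add lin_mult)
      fix e assume "R e \<and> R' e"
      then have "N * s e = t e" "N' * s' e = t' e" using 1(4)[OF a(1)] 2(4)[OF a(2)] by auto
      then show "N * N' * (s e + s' e) = N' * t e + N * t' e"
        by (simp flip: \<open>N * s e = t e\<close> \<open>N' * s' e = t' e\<close> add: algebra_simps)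
    qed
    show "\<forall>e. \<exists>(R, t)\<in>?c ` (F \<times> F'). R e"
    proof
      fix e
      obtain R t R' t' where "((R, t), (R', t')) \<in> F \<times> F'" "R e" "R' e"
        using 1(3)[of e] 2(3)[of e] by auto
      then show "\<exists>(R, t)\<in>?c ` (F \<times> F'). R e"
        by (intro bexI[OF _ imageI[of "((R, t), (R', t'))"]]) auto
    qed
  qed
qed

lemma pw_linear_mult:
  assumes "pw_linear V s"
  shows "pw_linear V (\<lambda>e. k * s e)"
proof -
  obtain N F where 1: "N > 0" "finite F" "\<And>e. \<exists>(R, t)\<in>F. R e"
    "\<And>R t. (R, t) \<in> F \<Longrightarrow> definable V R \<and> lin V t \<and> (\<forall>e. R e \<longrightarrow> N * s e = t e)"
    using assms(1) unfolding pw_linear_def by blast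
  let ?c = "\<lambda>(R, t). (R, \<lambda>e. k * t e)"
  show ?thesis unfolding pw_linear_def
  proof (intro exI conjI)
    show "finite (?c ` F)" "N > 0" using 1 by auto
    show "\<forall>(R, t)\<in>?c ` F. definable V R \<and> lin V t \<and> (\<forall>e. R e \<longrightarrow> N * (k * s e) = t e)"
      using 1(4) by (fastforce intro: lin_mult)
    show "\<forall>e. \<exists>(R, t)\<in>?c ` F. R e" using 1(3) by fastforce
  qed
qed

text \<open>Where \<open>s\<close> has remainder \<open>j\<close>, the quotient is
  \<open>(s - j) / m\<close>, with numerator \<open>t - N * j\<close> over the denominator
  \<open>N * m\<close>. The remainder condition is itself a divisibility, hence definable.\<close>

lemma pw_linear_div:
  assumes "pw_linear V s" "m > 0"
  shows "pw_linear V (\<lambda>e. s e div m)"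
proof -
  obtain N F where 1: "N > 0" "finite F" "\<And>e. \<exists>(R, t)\<in>F. R e"
    "\<And>R t. (R, t) \<in> F \<Longrightarrow> definable V R \<and> lin V t \<and> (\<forall>e. R e \<longrightarrow> N * s e = t e)"
    using assms(1) unfolding pw_linear_def by blast
  let ?c = "\<lambda>((R, t), j). (\<lambda>e. R e \<and> N * m dvd t e + (- (N * j)), \<lambda>e. t e + (- (N * j)))"
  have step: "N * m dvd N * z + (- (N * j)) \<longleftrightarrow> m dvd z - j" for z j
  proof -
    have "N * z + (- (N * j)) = N * (z - j)" by (simp add: algebra_simps)
    then show ?thesis using \<open>N > 0\<close> by simp
  qed
  show ?thesis unfolding pw_linear_def
  proof (intro exI conjI)
    show "finite (?c ` (F \<times> {0..<m}))" "N * m > 0" using 1 assms by auto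
    show "\<forall>(R, t)\<in>?c ` (F \<times> {0..<m}). definable V R \<and> lin V t \<and> (\<forall>e. R e \<longrightarrow> N * m * (s e div m) = t e)"
    proof (clarsimp, intro conjI allI impI)
      fix R t j assume a: "(R, t) \<in> F" "0 \<le> j" "j < m"
      show l: "lin V (\<lambda>e. t e - N * j)"
        using 1(4)[OF a(1)] lin_add[OF _ lin_const[of V "- (N * j)"], of t] by auto
      show "definable V (\<lambda>e. R e \<and> N * m dvd t e - N * j)"
        using 1(4)[OF a(1)] 1(1) assms l by (auto intro!: definable_and definable_lin_dvd)
      fix e assume e: "R e \<and> N * m dvd t e - N * j"
      then have t: "N * s e = t e" using 1(4)[OF a(1)] by auto
      with e step have "m dvd s e - j" by (metis uminus_add_conv_diff add.commute)
      then have "s e mod m = j" using a by (metis mod_eq_dvd_iff mod_pos_pos_trivial)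
      then have "m * (s e div m) = s e - j" by (metis minus_mod_eq_mult_div)
      then show "N * m * (s e div m) = t e - N * j" using t by (metis mult.assoc right_diff_distrib)
    qed
    show "\<forall>e. \<exists>(R, t)\<in>?c ` (F \<times> {0..<m}). R e"
    proof
      fix e
      obtain R t where a: "(R, t) \<in> F" "R e" using 1(3)[of e] by auto
      then have "N * s e = t e" using 1(4) by blast
      then have "N * m dvd t e + (- (N * (s e mod m)))" using step[of "s e" "s e mod m"] by simp
      moreover have "((R, t), s e mod m) \<in> F \<times> {0..<m}" using a assms by simp
      ultimately show "\<exists>(R, t)\<in>?c ` (F \<times> {0..<m}). R e" using a
        by (intro bexI[OF _ imageI[of "((R, t), s e mod m)"]]) auto
    qed
  qed
qed

text \<open>On a piece only the multiple \<open>N * s\<close> is a term, so a condition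
  \<open>S\<close> on \<open>s\<close> has to be restated as a condition \<open>Q N\<close> on that
  multiple.\<close>

lemma definable_pw_linear_linI:
  assumes "pw_linear V s"
    and "\<And>N t. N > 0 \<Longrightarrow> lin V t \<Longrightarrow> definable V (\<lambda>e. Q N (t e))"
    and "\<And>N z. N > 0 \<Longrightarrow> Q N (N * z) \<longleftrightarrow> S z"
  shows "definable V (\<lambda>e. S (s e))"
proof -
  obtain N F where 1: "N > 0" "finite F" "\<And>e. \<exists>(R, t)\<in>F. R e"
    "\<And>R t. (R, t) \<in> F \<Longrightarrow> definable V R \<and> lin V t \<and> (\<forall>e. R e \<longrightarrow> N * s e = t e)"
    using assms(1) unfolding pw_linear_def by blast
  have "S (s e) \<longleftrightarrow> (\<exists>p\<in>F. fst p e \<and> Q N (snd p e))" for e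
  proof -
    have "Q N (t e) \<longleftrightarrow> S (s e)" if "(R, t) \<in> F" "R e" for R t
      using 1(4)[OF that(1)] that(2) assms(3)[OF 1(1), of "s e"] by auto
    moreover obtain R t where "(R, t) \<in> F" "R e" using 1(3)[of e] by auto
    ultimately show ?thesis by (metis fst_conv snd_conv prod.collapse)
  qed
  moreover have "definable V (\<lambda>e. \<exists>p\<in>F. fst p e \<and> Q N (snd p e))"
    using 1 assms(2) by (intro definable_bex definable_and) auto
  ultimately show ?thesis by simp
qed

lemma definable_pw_linear_eq_0: "pw_linear V s \<Longrightarrow> definable V (\<lambda>e. s e = 0)"
  by (rule definable_pw_linear_linI[where Q = "\<lambda>_ z. z = 0"]) (auto intro: definable_lin_eq_0)

text \<open>Here the predicates with index above 1 enter: \<open>N * s\<close> lies in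
  \<open>D_plus r (nat N)\<close> iff \<open>s\<close> lies in the Beatty set.\<close>

lemma definable_pw_linear_beatty: "pw_linear V s \<Longrightarrow> definable V (\<lambda>e. s e \<in> beatty_set r)"
  by (rule definable_pw_linear_linI[where Q = "\<lambda>N z. z \<in> D_plus r (nat N)"]) (simp_all add: definable_lin_D_plus, simp add: D_plus_iff)

lemma definable_pw_linear_dvd: "pw_linear V s \<Longrightarrow> m > 0 \<Longrightarrow> definable V (\<lambda>e. m dvd s e)"
  by (rule definable_pw_linear_linI[where Q = "\<lambda>N z. N * m dvd z"]) (auto intro: definable_lin_dvd)

lemma definable_fr_less_neg:
  assumes "pw_linear V s" "n > 0"
  shows "definable V (\<lambda>e. fr (s e) < fr (- int n))"
proof -
  have "definable V (\<lambda>e. s e + int i \<in> beatty_set r \<or> s e + int i = - 1)" for i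
    using definable_pw_linear_eq_0[OF pw_linear_add[OF assms(1) pw_linear_const], of "int i + 1"]
    by (intro definable_or definable_pw_linear_beatty pw_linear_add assms pw_linear_const) (simp add: algebra_simps eq_neg_iff_add_eq_0)
  then show ?thesis
    unfolding fr_less_neg_iff[OF assms(2)]
    by (intro definable_not definable_bex definable_ball) (auto intro: finite_subset)
qed

subsection \<open>Signs of combinations of fractional parts\<close>

text \<open>Real values are not elements of the structure; a definable case distinction with one
  constant per case stands in for evaluating \<open>w\<close>.\<close>

definition approximable :: "nat set \<Rightarrow> ((nat \<Rightarrow> int) \<Rightarrow> real) \<Rightarrow> bool" where
  "approximable V w \<longleftrightarrow> (\<forall>\<epsilon>>0. \<exists>F. finite F \<and>
     (\<forall>(R, c)\<in>F. definable V R \<and> (\<forall>e. R e \<longrightarrow> \<bar>w e - c\<bar> < \<epsilon>)) \<and> (\<forall>e. \<exists>(R, c)\<in>F. R e))"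

text \<open>Coefficients are not recorded. Only two features of a combination matter for its sign:
  its size up to any error, and its class modulo 1, which is that of some
  \<open>alpha * y\<close>.\<close>

definition fr_comb :: "nat set \<Rightarrow> ((nat \<Rightarrow> int) \<Rightarrow> real) \<Rightarrow> bool" where
  "fr_comb V w \<longleftrightarrow> approximable V w \<and> (\<exists>y. pw_linear V y \<and> (\<forall>e. w e - alpha * of_int (y e) \<in> \<int>))"

lemma approximableE:
  assumes "approximable V w" "\<epsilon> > 0"
  obtains F where "finite F" "\<forall>e. \<exists>(R, c)\<in>F. R e"
    "\<forall>R c. (R, c) \<in> F \<longrightarrow> definable V R \<and> (\<forall>e. R e \<longrightarrow> \<bar>w e - c\<bar> < \<epsilon>)"
proof -
  obtain F where F: "finite F \<and> (\<forall>(R, c)\<in>F. definable V R \<and> (\<forall>e. R e \<longrightarrow> \<bar>w e - c\<bar> < \<epsilon>)) \<and>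
      (\<forall>e. \<exists>(R, c)\<in>F. R e)"
    using assms(1)[unfolded approximable_def, rule_format, OF assms(2)] by (elim exE)
  show thesis by (rule that[of F]) (use F in \<open>auto split: prod.splits\<close>)
qed

lemma approximable_const: "approximable V (\<lambda>_. c)"
  unfolding approximable_def by (intro allI impI exI[of _ "{(\<lambda>_. True, c)}"]) (auto intro: definable_const)

lemma approximable_add:
  assumes "approximable V w" "approximable V w'"
  shows "approximable V (\<lambda>e. w e + w' e)"
  unfolding approximable_def
proof (intro allI impI)
  fix \<epsilon> :: real assume "\<epsilon> > 0"
  then have e2: "\<epsilon> / 2 > 0" by simp
  obtain F where 1: "finite F" "\<forall>e. \<exists>(R, c)\<in>F. R e"
    "\<forall>R c. (R, c) \<in> F \<longrightarrow> definable V R \<and> (\<forall>e. R e \<longrightarrow> \<bar>w e - c\<bar> < \<epsilon> / 2)"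
    by (rule approximableE[OF assms(1) e2])
  obtain F' where 2: "finite F'" "\<forall>e. \<exists>(R, c)\<in>F'. R e"
    "\<forall>R c. (R, c) \<in> F' \<longrightarrow> definable V R \<and> (\<forall>e. R e \<longrightarrow> \<bar>w' e - c\<bar> < \<epsilon> / 2)"
    by (rule approximableE[OF assms(2) e2])
  let ?c = "\<lambda>((R, c), (R', c')). (\<lambda>e. R e \<and> R' e, c + c')"
  show "\<exists>F. finite F \<and> (\<forall>(R, c)\<in>F. definable V R \<and> (\<forall>e. R e \<longrightarrow> \<bar>w e + w' e - c\<bar> < \<epsilon>)) \<and>
    (\<forall>e. \<exists>(R, c)\<in>F. R e)"
  proof (intro exI conjI)
    show "finite (?c ` (F \<times> F'))" using 1 2 by simp
    show "\<forall>(R, c)\<in>?c ` (F \<times> F'). definable V R \<and> (\<forall>e. R e \<longrightarrow> \<bar>w e + w' e - c\<bar> < \<epsilon>)"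
    proof (clarsimp, intro conjI allI impI)
      fix R c R' c' assume a: "(R, c) \<in> F" "(R', c') \<in> F'"
      show "definable V (\<lambda>e. R e \<and> R' e)"
        using 1(3)[rule_format, OF a(1)] 2(3)[rule_format, OF a(2)] by (intro definable_and) auto
      fix e assume "R e \<and> R' e"
      then have "\<bar>w e - c\<bar> < \<epsilon> / 2" "\<bar>w' e - c'\<bar> < \<epsilon> / 2" using 1(3)[rule_format, OF a(1)] 2(3)[rule_format, OF a(2)] by auto
      then show "\<bar>w e + w' e - (c + c')\<bar> < \<epsilon>" by linarith
    qed
    show "\<forall>e. \<exists>(R, c)\<in>?c ` (F \<times> F'). R e"
    proof
      fix e
      obtain R c R' c' where "((R, c), (R', c')) \<in> F \<times> F'" "R e" "R' e"
        using 1(2)[rule_format, of e] 2(2)[rule_format, of e] by auto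
      then show "\<exists>(R, c)\<in>?c ` (F \<times> F'). R e"
        by (intro bexI[OF _ imageI[of "((R, c), (R', c'))"]]) auto
    qed
  qed
qed

lemma approximable_minus:
  assumes "approximable V w"
  shows "approximable V (\<lambda>e. - w e)"
  unfolding approximable_def
proof (intro allI impI)
  fix \<epsilon> :: real assume "\<epsilon> > 0"
  then obtain F where 1: "finite F" "\<forall>e. \<exists>(R, c)\<in>F. R e"
    "\<forall>R c. (R, c) \<in> F \<longrightarrow> definable V R \<and> (\<forall>e. R e \<longrightarrow> \<bar>w e - c\<bar> < \<epsilon>)"
    by (rule approximableE[OF assms])
  let ?c = "\<lambda>(R, c). (R, - c)"
  show "\<exists>F. finite F \<and> (\<forall>(R, c)\<in>F. definable V R \<and> (\<forall>e. R e \<longrightarrow> \<bar>- w e - c\<bar> < \<epsilon>)) \<and>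
    (\<forall>e. \<exists>(R, c)\<in>F. R e)"
  proof (intro exI conjI)
    show "finite (?c ` F)" using 1 by simp
    show "\<forall>(R, c)\<in>?c ` F. definable V R \<and> (\<forall>e. R e \<longrightarrow> \<bar>- w e - c\<bar> < \<epsilon>)"
      using 1(3) by (auto simp: abs_minus_commute)
    show "\<forall>e. \<exists>(R, c)\<in>?c ` F. R e" using 1(2) by fastforce
  qed
qed

text \<open>One definable cut \<open>fr (- n i)\<close> is chosen inside each interval of a grid of
  width \<open>1 / N\<close>, in place of the grid points.\<close>

lemma approximable_fr:
  assumes "pw_linear V s"
  shows "approximable V (\<lambda>e. fr (s e))"
  unfolding approximable_def
proof (intro allI impI)
  fix \<epsilon> :: real assume "\<epsilon> > 0"
  obtain N :: nat where "2 / \<epsilon> < real N" using reals_Archimedean2 by blast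
  then have N': "2 < \<epsilon> * real N" using \<open>\<epsilon> > 0\<close> by (simp add: pos_divide_less_eq mult.commute)
  then have "N > 0" by (cases N) auto
  with N' have N: "N > 0" "2 / real N < \<epsilon>" by (simp_all add: pos_divide_less_eq)
  have "\<exists>n>0. real i / N < fr (- int n) \<and> fr (- int n) < (real i + 1) / N" if "i < N" for i
  proof -
    have "0 \<le> real i / N" "real i / N < (real i + 1) / N" "(real i + 1) / N \<le> 1"
      using that by (simp_all add: divide_strict_right_mono)
    from fr_dense_neg[OF this]
    obtain n where "n > 0" "real i / N < fr (- int n)" "fr (- int n) < (real i + 1) / N" .
    then show ?thesis by blast
  qed
  then obtain n where n: "\<And>i. i < N \<Longrightarrow> n i > 0" "\<And>i. i < N \<Longrightarrow> real i / N < fr (- int (n i))"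
    "\<And>i. i < N \<Longrightarrow> fr (- int (n i)) < (real i + 1) / N" by metis
  \<comment> \<open>Region \<open>i\<close> is meant for values in
    \<open>[i / N, (i + 1) / N)\<close>. The cut inside that interval may lie on either side of the
    value, so only the neighbouring cuts are tested; this leaves an error below
    \<open>2 / N\<close>. At the ends the bounds 0 and 1 replace a missing neighbour.\<close>
  define R where "R i e \<longleftrightarrow> (1 \<le> i \<longrightarrow> \<not> fr (s e) < fr (- int (n (i - 1)))) \<and>
    (i + 1 < N \<longrightarrow> fr (s e) < fr (- int (n (i + 1))))" for i e
  show "\<exists>F. finite F \<and> (\<forall>(R, c)\<in>F. definable V R \<and> (\<forall>e. R e \<longrightarrow> \<bar>fr (s e) - c\<bar> < \<epsilon>)) \<and>
    (\<forall>e. \<exists>(R, c)\<in>F. R e)"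
  proof (intro exI conjI)
    show "finite ((\<lambda>i. (R i, real i / N)) ` {..<N})" by simp
    show "\<forall>(R, c)\<in>(\<lambda>i. (R i, real i / N)) ` {..<N}. definable V R \<and> (\<forall>e. R e \<longrightarrow> \<bar>fr (s e) - c\<bar> < \<epsilon>)"
    proof (clarsimp, intro conjI allI impI)
      fix i assume i: "i < N"
      have "definable V (\<lambda>e. i + 1 < N \<longrightarrow> fr (s e) < fr (- int (n (i + 1))))"
        by (cases "i + 1 < N") (use assms n(1) in \<open>auto intro!: definable_fr_less_neg definable_const\<close>)
      moreover have "definable V (\<lambda>e. 1 \<le> i \<longrightarrow> \<not> fr (s e) < fr (- int (n (i - 1))))"
        using assms n(1)[of "i - 1"] i by (intro definable_imp definable_not definable_const definable_fr_less_neg) auto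
      ultimately show "definable V (R i)" unfolding R_def by (intro definable_and)
      fix e assume "R i e"
      have "(real i - 1) / N < fr (s e)"
      proof (cases "1 \<le> i")
        case True
        then have "real (i - 1) / N < fr (- int (n (i - 1)))" using i n(2)[of "i - 1"] by simp
        with True \<open>R i e\<close> show ?thesis by (simp add: R_def of_nat_diff)
      next
        case False
        then have "i = 0" by simp
        then have "(real i - 1) / N < 0" using N by simp
        with fr_bounds[of "s e"] show ?thesis by linarith
      qed
      moreover have "fr (s e) < (real i + 2) / N"
      proof (cases "i + 1 < N")
        case True
        then have "fr (- int (n (i + 1))) < (real i + 2) / N" using n(3)[of "i + 1"] by (simp add: add.commute)
        with True \<open>R i e\<close> show ?thesis by (simp add: R_def)
      next
        case False
        then have "1 \<le> (real i + 2) / N" using N by (simp add: field_simps)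
        with fr_bounds[of "s e"] show ?thesis by linarith
      qed
      ultimately have "- (1 / N) < fr (s e) - real i / N" "fr (s e) - real i / N < 2 / N"
        by (simp_all add: diff_divide_distrib add_divide_distrib)
      moreover have "1 / real N \<le> 2 / N" by (simp add: divide_right_mono)
      ultimately show "\<bar>fr (s e) - real i / N\<bar> < \<epsilon>" using N(2) unfolding abs_less_iff by argo
    qed
    show "\<forall>e. \<exists>(R, c)\<in>(\<lambda>i. (R i, real i / N)) ` {..<N}. R e"
    proof
      fix e
      define i where "i = nat \<lfloor>N * fr (s e)\<rfloor>"
      have i: "real i \<le> N * fr (s e)" "N * fr (s e) < real i + 1"
        using fr_bounds[of "s e"] by (auto simp: i_def)
      moreover have "N * fr (s e) < N" using fr_bounds[of "s e"] N by simp
      ultimately have "i < N" by linarith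
      have b: "real i / N \<le> fr (s e)" "fr (s e) < (real i + 1) / N" using i N by (auto simp: field_simps)
      have "R i e" unfolding R_def
      proof (intro conjI impI)
        assume "1 \<le> i"
        then show "\<not> fr (s e) < fr (- int (n (i - 1)))"
          using n(3)[of "i - 1"] less_imp_diff_less[OF \<open>i < N\<close>, of 1] b by (simp add: of_nat_diff)
      next
        assume "i + 1 < N"
        then show "fr (s e) < fr (- int (n (i + 1)))"
          using n(2)[of "i + 1"] b by (simp add: add.commute)
      qed
      with \<open>i < N\<close> show "\<exists>(R, c)\<in>(\<lambda>i. (R i, real i / N)) ` {..<N}. R e" by auto
    qed
  qed
qed

lemma fr_comb_fr: "pw_linear V s \<Longrightarrow> fr_comb V (\<lambda>e. fr (s e))"
  unfolding fr_comb_def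
  by (intro conjI approximable_fr exI[of _ s]) (auto simp: fr_def frac_def)

lemma fr_comb_const: "fr_comb V (\<lambda>_. of_int b + of_int c * alpha)"
  unfolding fr_comb_def
  by (intro conjI approximable_const exI[of _ "\<lambda>_. c"]) (auto simp: pw_linear_const mult.commute)

lemma fr_comb_add:
  assumes "fr_comb V w" "fr_comb V w'"
  shows "fr_comb V (\<lambda>e. w e + w' e)"
proof -
  obtain y y' where "pw_linear V y" "pw_linear V y'"
    and y: "\<And>e. w e - alpha * of_int (y e) \<in> \<int>" "\<And>e. w' e - alpha * of_int (y' e) \<in> \<int>"
    using assms unfolding fr_comb_def by blast
  moreover have "w e + w' e - alpha * of_int (y e + y' e) \<in> \<int>" for e
    using Ints_add[OF y(1)[of e] y(2)[of e]] by (simp add: algebra_simps)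
  ultimately show ?thesis
    using assms unfolding fr_comb_def
    by (intro conjI approximable_add exI[of _ "\<lambda>e. y e + y' e"] pw_linear_add) auto
qed

lemma fr_comb_minus:
  assumes "fr_comb V w"
  shows "fr_comb V (\<lambda>e. - w e)"
proof -
  obtain y where "pw_linear V y" and y: "\<And>e. w e - alpha * of_int (y e) \<in> \<int>"
    using assms unfolding fr_comb_def by blast
  moreover have "- w e - alpha * of_int (- 1 * y e) \<in> \<int>" for e
    using Ints_minus[OF y[of e]] by (simp add: algebra_simps)
  ultimately show ?thesis
    using assms unfolding fr_comb_def
    by (intro conjI approximable_minus exI[of _ "\<lambda>e. - 1 * y e"] pw_linear_mult) auto
qed

lemma fr_comb_mult: "fr_comb V w \<Longrightarrow> fr_comb V (\<lambda>e. of_int k * w e)"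
proof (induction k rule: int_induct[where k = 0])
  case base
  show ?case using fr_comb_const[of V 0 0] by simp
next
  case (step1 i)
  then show ?case using fr_comb_add[of V "\<lambda>e. of_int i * w e" w] by (simp add: algebra_simps)
next
  case (step2 i)
  then show ?case
    using fr_comb_add[OF _ fr_comb_minus, of V "\<lambda>e. of_int i * w e" w] by (simp add: algebra_simps)
qed

text \<open>Away from \<open>0\<close> an approximation decides the sign; near \<open>0\<close> the sign of \<open>w\<close> is
  the side on which \<open>fr y\<close> lies, which one cut point \<open>fr (- n)\<close> detects.\<close>

lemma definable_fr_comb_pos:
  assumes "fr_comb V w"
  shows "definable V (\<lambda>e. 0 < w e)"
proof -
  obtain y where "pw_linear V y" and y: "\<And>e. w e - alpha * of_int (y e) \<in> \<int>"
    using assms unfolding fr_comb_def by blast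
  have "approximable V w" using assms by (simp add: fr_comb_def)
  then obtain F where F: "finite F" "\<forall>e. \<exists>(R, c)\<in>F. R e"
    "\<forall>R c. (R, c) \<in> F \<longrightarrow> definable V R \<and> (\<forall>e. R e \<longrightarrow> \<bar>w e - c\<bar> < 1 / 8)"
    by (rule approximableE[of V w "1 / 8"]) simp
  \<comment> \<open>If \<open>c\<close> is below \<open>1 / 8\<close> in absolute value, then
    \<open>w\<close> is below \<open>1 / 4\<close>, and \<open>fr y\<close> is \<open>w\<close> or
    \<open>w + 1\<close>: less than \<open>1 / 4\<close> or more than \<open>3 / 4\<close>. A cut
    between these separates the cases; \<open>y e \<noteq> 0\<close> rules out
    \<open>w = 0\<close>.\<close>
  obtain n where n: "n > 0" "1 / 4 < fr (- int n)" "fr (- int n) < 3 / 4"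
    using fr_dense_neg[of "1 / 4" "3 / 4"] by auto
  define S where "S c e \<longleftrightarrow> c \<ge> 1 / 8 \<or> (c > - 1 / 8 \<and> y e \<noteq> 0 \<and> fr (y e) < fr (- int n))" for c :: real and e
  have S: "0 < w e \<longleftrightarrow> S c e" if "\<bar>w e - c\<bar> < 1 / 8" for c e
  proof -
    consider "c \<ge> 1 / 8" | "c \<le> - 1 / 8" | "\<bar>c\<bar> < 1 / 8" by linarith
    then show ?thesis
    proof cases
      case 3
      with that have w: "\<bar>w e\<bar> < 1 / 4" by linarith
      have i: "alpha * of_int (y e) - w e \<in> \<int>" using y[of e] by (metis Ints_minus minus_diff_eq)
      consider "w e > 0" | "w e = 0" | "w e < 0" by linarith
      then show ?thesis
      proof cases
        case 1
        then have "fr (y e) = w e" using w i by (intro fr_eqI) auto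
        with 1 3 w n show ?thesis by (auto simp: S_def fr_0)
      next
        case 2
        then have "y e = 0" using i alpha_mult_in_Ints_iff by simp
        with 2 3 show ?thesis by (auto simp: S_def)
      next
        case 3
        have "alpha * of_int (y e) - (w e + 1) \<in> \<int>" using Ints_diff[OF i Ints_1] by (simp add: algebra_simps)
        then have "fr (y e) = w e + 1" using w 3 by (intro fr_eqI) auto
        with 3 \<open>\<bar>c\<bar> < 1 / 8\<close> w n show ?thesis by (auto simp: S_def)
      qed
    next
      case 1
      with that have "0 < w e" by linarith
      with 1 show ?thesis by (simp add: S_def)
    next
      case 2
      with that have "w e < 0" by linarith
      with 2 show ?thesis by (auto simp: S_def)
    qed
  qed
  have "0 < w e \<longleftrightarrow> (\<exists>p\<in>F. fst p e \<and> S (snd p) e)" for e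
  proof -
    have "0 < w e \<longleftrightarrow> S c e" if "(R, c) \<in> F" "R e" for R c
      using F(3)[rule_format, OF that(1)] that(2) S by blast
    moreover obtain R c where "(R, c) \<in> F" "R e" using F(2)[rule_format, of e] by auto
    ultimately show ?thesis by (metis fst_conv snd_conv prod.collapse)
  qed
  moreover have "definable V (\<lambda>e. \<exists>p\<in>F. fst p e \<and> S (snd p) e)"
  proof (intro definable_bex definable_and F(1))
    fix p assume "p \<in> F"
    then show "definable V (fst p)" using F(3)[rule_format, of "fst p" "snd p"] by simp
    show "definable V (S (snd p))" unfolding S_def
      using \<open>pw_linear V y\<close> n by (intro definable_or definable_and definable_not definable_const definable_pw_linear_eq_0 definable_fr_less_neg)
  qed
  ultimately show ?thesis by simp
qed

section \<open>Comparison of cut points\<close>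

text \<open>A combination divided by an integer need not be congruent to any
  \<open>alpha * y\<close> modulo 1, but a positive denominator can be cleared in
  comparisons.\<close>

definition cut :: "nat set \<Rightarrow> ((nat \<Rightarrow> int) \<Rightarrow> real) \<Rightarrow> bool" where
  "cut V p \<longleftrightarrow> (\<exists>K>0. fr_comb V (\<lambda>e. of_int K * p e))"

lemma cut_divide:
  assumes "fr_comb V w" "k \<noteq> 0"
  shows "cut V (\<lambda>e. w e / of_int k)"
proof -
  have "of_int \<bar>k\<bar> * (w e / of_int k) = of_int (sgn k) * w e" for e
    using assms(2) by (cases "k > 0") auto
  then show ?thesis using fr_comb_mult[OF assms(1), of "sgn k"] assms(2)
    unfolding cut_def by (intro exI[of _ "\<bar>k\<bar>"]) simp
qed

lemma cut_const: "cut V (\<lambda>_. of_int b)"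
  using cut_divide[OF fr_comb_const[of V b 0], of 1] by simp

lemma definable_cut_less:
  assumes "cut V p" "cut V q"
  shows "definable V (\<lambda>e. p e < q e)"
proof -
  obtain K L where K: "K > 0" "fr_comb V (\<lambda>e. of_int K * p e)" and L: "L > 0" "fr_comb V (\<lambda>e. of_int L * q e)"
    using assms unfolding cut_def by blast
  let ?w = "\<lambda>e. of_int K * (of_int L * q e) + - (of_int L * (of_int K * p e))"
  have "definable V (\<lambda>e. 0 < ?w e)"
    by (intro definable_fr_comb_pos fr_comb_add fr_comb_minus fr_comb_mult K L)
  moreover have "0 < ?w e \<longleftrightarrow> p e < q e" for e
  proof -
    have "?w e = of_int K * of_int L * (q e - p e)" by (simp add: algebra_simps)
    moreover have "0 < real_of_int K * of_int L" using K L by simp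
    ultimately show ?thesis using zero_less_mult_iff[of "of_int K * of_int L" "q e - p e"] by linarith
  qed
  ultimately show ?thesis by simp
qed

subsection \<open>Elimination of one quantifier\<close>

text \<open>The shape left after the split into residue classes: \<open>a\<close> is the quantified
  variable, and conditions free of \<open>a\<close>, such as divisibilities, are parameters.\<close>

inductive bool_comb :: "nat set \<Rightarrow> ((nat \<Rightarrow> int) \<Rightarrow> int \<Rightarrow> bool) \<Rightarrow> bool" for V where
  bool_comb_beatty: "pw_linear V s \<Longrightarrow> bool_comb V (\<lambda>e a. k * a + s e \<in> beatty_set r)"
| bool_comb_eq: "pw_linear V s \<Longrightarrow> bool_comb V (\<lambda>e a. k * a + s e = 0)"
| bool_comb_param: "definable V R \<Longrightarrow> bool_comb V (\<lambda>e a. R e)"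
| bool_comb_not: "bool_comb V B \<Longrightarrow> bool_comb V (\<lambda>e a. \<not> B e a)"
| bool_comb_or: "bool_comb V B \<Longrightarrow> bool_comb V B' \<Longrightarrow> bool_comb V (\<lambda>e a. B e a \<or> B' e a)"

lemma bool_comb_and: "bool_comb V B \<Longrightarrow> bool_comb V B' \<Longrightarrow> bool_comb V (\<lambda>e a. B e a \<and> B' e a)"
  using bool_comb_not[OF bool_comb_or[OF bool_comb_not bool_comb_not, of V B B']] by simp

lemma definable_bool_comb_subst:
  assumes "bool_comb V B" "pw_linear V g"
  shows "definable V (\<lambda>e. B e (g e))"
  using assms
  by (induction rule: bool_comb.induct)
    (simp_all add: definable_pw_linear_beatty definable_pw_linear_eq_0 pw_linear_add pw_linear_mult definable_not definable_or)

text \<open>Outside the finitely many exceptional points given by \<open>E\<close>, the truth of \<open>B e a\<close> depends only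
  on the position of \<open>fr a\<close> among the cut points in \<open>C\<close>.\<close>

definition cell_form :: "nat set \<Rightarrow> ((nat \<Rightarrow> int) \<Rightarrow> int \<Rightarrow> bool) \<Rightarrow> ((nat \<Rightarrow> int) \<Rightarrow> real) set \<Rightarrow>
    (int \<times> ((nat \<Rightarrow> int) \<Rightarrow> int)) set \<Rightarrow> (((nat \<Rightarrow> int) \<Rightarrow> real) set \<Rightarrow> (nat \<Rightarrow> int) \<Rightarrow> bool) \<Rightarrow> bool" where
  "cell_form V B C E T \<longleftrightarrow> finite C \<and> finite E \<and> (\<forall>p\<in>C. cut V p) \<and>
     (\<forall>(k, s)\<in>E. k \<noteq> 0 \<and> pw_linear V s) \<and> (\<forall>\<sigma>. definable V (T \<sigma>)) \<and>
     (\<forall>e a. (\<forall>(k, s)\<in>E. k * a + s e \<noteq> 0) \<longrightarrow>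
        (\<forall>p\<in>C. fr a \<noteq> p e) \<and> (B e a \<longleftrightarrow> T {p\<in>C. p e < fr a} e))"

text \<open>Modulo 1 the number \<open>alpha * (k * a + s)\<close> equals
  \<open>z = k * fr a + fr s\<close>, so the atom says that \<open>z\<close> lies less than
  \<open>alpha\<close> below an integer \<open>j\<close>. As \<open>z\<close> lies between
  \<open>- \<bar>k\<bar>\<close> and \<open>\<bar>k\<bar> + 1\<close>, finitely many
  \<open>j\<close> suffice.\<close>

lemma beatty_set_linear_iff:
  fixes k :: int
  defines "J \<equiv> {- \<bar>k\<bar> - 1..\<bar>k\<bar> + 2}"
  shows "k * a + s \<in> beatty_set r \<longleftrightarrow>
    (\<exists>j\<in>J. of_int j - alpha < of_int k * fr a + fr s \<and> of_int k * fr a + fr s < of_int j)"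
proof -
  define z where "z = of_int k * fr a + fr s"
  have "alpha * of_int (k * a + s) - (z - of_int \<lfloor>z\<rfloor>) =
      of_int k * (alpha * of_int a - fr a) + (alpha * of_int s - fr s) + of_int \<lfloor>z\<rfloor>"
    by (simp add: z_def algebra_simps)
  also have "\<dots> \<in> \<int>" by (intro Ints_add Ints_mult Ints_of_int fr_diff_in_Ints)
  finally have fr_eq: "fr (k * a + s) = z - of_int \<lfloor>z\<rfloor>" by (intro fr_eqI; linarith)
  have "\<bar>of_int k * fr a\<bar> \<le> \<bar>of_int k\<bar>"
    using fr_bounds[of a] by (simp add: abs_mult mult_left_le)
  then have "- of_int \<bar>k\<bar> \<le> z" "z < of_int \<bar>k\<bar> + 1" using fr_bounds[of s] by (auto simp: z_def)
  then have "\<lfloor>z\<rfloor> + 1 \<in> J" unfolding J_def by (auto simp: le_floor_iff floor_less_iff) linarith+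
  moreover have "1 - alpha < z - of_int \<lfloor>z\<rfloor> \<longleftrightarrow> of_int (\<lfloor>z\<rfloor> + 1) - alpha < z" by auto
  moreover have "z < of_int (\<lfloor>z\<rfloor> + 1)" by linarith
  moreover have "j = \<lfloor>z\<rfloor> + 1" if "of_int j - alpha < z" "z < of_int j" for j
  proof -
    have "\<lfloor>z\<rfloor> = j - 1" using that alpha_less_1 by (auto simp: floor_eq_iff)
    then show ?thesis by simp
  qed
  ultimately show ?thesis unfolding beatty_set_iff fr_eq z_def[symmetric] by blast
qed

text \<open>Modulo 1 the hypothesis makes \<open>alpha * (k * a + s - c)\<close> an integer. Thus
  \<open>fr a\<close> can meet an interval endpoint only at the root of a linear equation.\<close>

lemma fr_comb_exceptional:
  assumes "of_int k * fr a + fr s = of_int j + of_int c * alpha"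
  shows "k * a + s = c"
proof -
  have "alpha * of_int (k * a + s - c) =
      of_int k * (alpha * of_int a - fr a) + (alpha * of_int s - fr s) + of_int j"
    using assms by (simp add: algebra_simps)
  moreover have "\<dots> \<in> \<int>" by (intro Ints_add Ints_mult Ints_of_int fr_diff_in_Ints)
  ultimately show ?thesis using alpha_mult_in_Ints_iff[of "k * a + s - c"] by simp
qed

text \<open>Solving for \<open>fr a\<close> gives the endpoints \<open>l j\<close> and
  \<open>u j\<close>, in reverse order when \<open>k < 0\<close>; the atom holds iff some such pair
  is separated by \<open>fr a\<close>. Endpoints are met only where \<open>k * a + s\<close> is 0 or
  \<open>- 1\<close>, whence the two equations in \<open>E\<close>.\<close>

lemma cell_form_beatty:
  assumes "pw_linear V s" "k \<noteq> 0"
  shows "\<exists>C E T. cell_form V (\<lambda>e a. k * a + s e \<in> beatty_set r) C E T"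
proof -
  define J where "J = {- \<bar>k\<bar> - 1..\<bar>k\<bar> + 2}"
  \<comment> \<open>The summand \<open>of_int 0 * alpha\<close> keeps the form of
    \<open>fr_comb_const\<close>.\<close>
  define u where "u j e = (of_int j + of_int 0 * alpha + - fr (s e)) / of_int k" for j e
  define l where "l j e = (of_int j + of_int (- 1) * alpha + - fr (s e)) / of_int k" for j e
  define C where "C = u ` J \<union> l ` J"
  define E where "E = {(k, s), (k, \<lambda>e. s e + 1)}"
  define T where "T \<sigma> e \<longleftrightarrow> (\<exists>j\<in>J. if k > 0 then l j \<in> \<sigma> \<and> u j \<notin> \<sigma> else u j \<in> \<sigma> \<and> l j \<notin> \<sigma>)" for \<sigma> and e :: "nat \<Rightarrow> int"
  have "cell_form V (\<lambda>e a. k * a + s e \<in> beatty_set r) C E T"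
    unfolding cell_form_def
  proof (intro conjI allI impI)
    show "finite C" "finite E" by (auto simp: C_def J_def E_def)
    have "cut V (u j)" "cut V (l j)" for j
      unfolding u_def l_def using assms
      by (intro cut_divide fr_comb_add fr_comb_minus fr_comb_const fr_comb_fr; simp)+
    then show "\<forall>p\<in>C. cut V p" by (auto simp: C_def)
    show "\<forall>(k, s)\<in>E. k \<noteq> 0 \<and> pw_linear V s"
      using assms pw_linear_add[OF assms(1) pw_linear_const] by (auto simp: E_def)
    show "definable V (T \<sigma>)" for \<sigma> unfolding T_def by (rule definable_const)
    fix e a assume "\<forall>(k, s)\<in>E. k * a + s e \<noteq> 0"
    then have ne: "k * a + s e \<noteq> 0" "k * a + s e \<noteq> - 1" by (auto simp: E_def)
    have u: "fr a \<noteq> u j e" and l: "fr a \<noteq> l j e" for j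
      using ne fr_comb_exceptional[of k a "s e" j 0] fr_comb_exceptional[of k a "s e" j "- 1"] assms
      by (auto simp: u_def l_def field_simps)
    then show "\<forall>p\<in>C. fr a \<noteq> p e" by (auto simp: C_def)
    let ?\<sigma> = "{p \<in> C. p e < fr a}"
    have mem: "u j \<in> ?\<sigma> \<longleftrightarrow> u j e < fr a" "l j \<in> ?\<sigma> \<longleftrightarrow> l j e < fr a" if "j \<in> J" for j
      using that by (auto simp: C_def)
    have "(if k > 0 then l j \<in> ?\<sigma> \<and> u j \<notin> ?\<sigma> else u j \<in> ?\<sigma> \<and> l j \<notin> ?\<sigma>) \<longleftrightarrow>
        of_int j - alpha < of_int k * fr a + fr (s e) \<and> of_int k * fr a + fr (s e) < of_int j"
      if "j \<in> J" for j
    proof (cases "k > 0")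
      case True
      then have "l j e < fr a \<longleftrightarrow> of_int j - alpha < of_int k * fr a + fr (s e)"
        "fr a < u j e \<longleftrightarrow> of_int k * fr a + fr (s e) < of_int j"
        by (auto simp: u_def l_def field_simps)
      with True u[of j] mem[OF that] show ?thesis by auto
    next
      case False
      then have "fr a < l j e \<longleftrightarrow> of_int j - alpha < of_int k * fr a + fr (s e)"
        "u j e < fr a \<longleftrightarrow> of_int k * fr a + fr (s e) < of_int j"
        using assms(2) by (auto simp: u_def l_def field_simps)
      with False l[of j] mem[OF that] show ?thesis by auto
    qed
    then show "k * a + s e \<in> beatty_set r \<longleftrightarrow> T ?\<sigma> e"
      unfolding beatty_set_linear_iff T_def J_def[symmetric] by (intro bex_cong) auto
  qed
  then show ?thesis by blast
qed

lemma cell_form_param: "definable V R \<Longrightarrow> cell_form V (\<lambda>e a. R e) {} {} (\<lambda>_. R)"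
  by (simp add: cell_form_def)

text \<open>Off its root the equation is false, so no cut point is required.\<close>

lemma cell_form_eq:
  "pw_linear V s \<Longrightarrow> k \<noteq> 0 \<Longrightarrow> cell_form V (\<lambda>e a. k * a + s e = 0) {} {(k, s)} (\<lambda>_ _. False)"
  by (simp add: cell_form_def definable_const)

lemma cell_form_not: "cell_form V B C E T \<Longrightarrow> cell_form V (\<lambda>e a. \<not> B e a) C E (\<lambda>\<sigma> e. \<not> T \<sigma> e)"
  by (simp add: cell_form_def definable_not)

lemma cell_form_or:
  assumes "cell_form V B C E T" "cell_form V B' C' E' T'"
  shows "cell_form V (\<lambda>e a. B e a \<or> B' e a) (C \<union> C') (E \<union> E') (\<lambda>\<sigma> e. T (\<sigma> \<inter> C) e \<or> T' (\<sigma> \<inter> C') e)"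
proof -
  have *: "{p \<in> C \<union> C'. p e < fr a} \<inter> C = {p \<in> C. p e < fr a}"
    "{p \<in> C \<union> C'. p e < fr a} \<inter> C' = {p \<in> C'. p e < fr a}" for e a by auto
  show ?thesis using assms unfolding cell_form_def * by (auto intro!: definable_or)
qed

lemma bool_comb_cell_form: "bool_comb V B \<Longrightarrow> \<exists>C E T. cell_form V B C E T"
proof (induction rule: bool_comb.induct)
  case (bool_comb_beatty s k)
  show ?case
  proof (cases "k = 0")
    case True
    then show ?thesis using cell_form_param[OF definable_pw_linear_beatty[OF bool_comb_beatty]] by auto
  qed (use bool_comb_beatty in \<open>rule cell_form_beatty\<close>)
next
  case (bool_comb_eq s k)
  show ?case
  proof (cases "k = 0")
    case True
    then show ?thesis using cell_form_param[OF definable_pw_linear_eq_0[OF bool_comb_eq]] by auto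
  qed (use bool_comb_eq cell_form_eq in blast)
qed (use cell_form_param cell_form_not cell_form_or in blast)+

text \<open>By density of \<open>fr\<close>, a cell contains a nonexceptional value \<open>fr a\<close> as soon as every lower
  bound of the cell is less than every upper bound.\<close>

lemma definable_bool_comb_ex:
  assumes "bool_comb V B"
  shows "definable V (\<lambda>e. \<exists>a. B e a)"
proof -
  obtain C E T where "cell_form V B C E T" using bool_comb_cell_form[OF assms] by blast
  then have fin: "finite C" "finite E" and cut: "\<And>p. p \<in> C \<Longrightarrow> cut V p"
    and E: "\<And>k s. (k, s) \<in> E \<Longrightarrow> k \<noteq> 0 \<and> pw_linear V s" and T: "\<And>\<sigma>. definable V (T \<sigma>)"
    and B: "\<And>e a. \<forall>(k, s)\<in>E. k * a + s e \<noteq> 0 \<Longrightarrow>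
        (\<forall>p\<in>C. fr a \<noteq> p e) \<and> (B e a \<longleftrightarrow> T {p\<in>C. p e < fr a} e)"
    unfolding cell_form_def by blast+
  \<comment> \<open>The root of \<open>k * a + s = 0\<close> if it is an integer;
    \<open>sgn k\<close> makes the divisor positive, as \<open>pw_linear_div\<close>
    demands.\<close>
  define g where "g k s e = (- sgn k * s e) div \<bar>k\<bar>" for k :: int and s :: "(nat \<Rightarrow> int) \<Rightarrow> int" and e
  \<comment> \<open>The bounds 0 and 1 confine \<open>fr a\<close> to its range and keep both sets
    nonempty.\<close>
  define L U where "L \<sigma> = insert (\<lambda>_. of_int 0) \<sigma>" and "U \<sigma> = insert (\<lambda>_. of_int 1) (C - \<sigma>)"
    for \<sigma> :: "((nat \<Rightarrow> int) \<Rightarrow> real) set"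
  have root: "k * a + s e = 0 \<longleftrightarrow> \<bar>k\<bar> dvd s e \<and> a = g k s e" if "k \<noteq> 0" for k a s e
  proof
    assume "k * a + s e = 0"
    then have s: "s e = - (k * a)" by simp
    then have "- sgn k * s e = \<bar>k\<bar> * a" using that by (cases "k > 0") simp_all
    then have "g k s e = \<bar>k\<bar> * a div \<bar>k\<bar>" unfolding g_def by (rule arg_cong)
    then have "g k s e = a" using that by simp
    then show "\<bar>k\<bar> dvd s e \<and> a = g k s e" using s by simp
  next
    assume a: "\<bar>k\<bar> dvd s e \<and> a = g k s e"
    then have "\<bar>k\<bar> dvd - sgn k * s e" by (intro dvd_mult) simp
    then have "\<bar>k\<bar> * a = - sgn k * s e" using a by (simp only: g_def dvd_mult_div_cancel)
    then show "k * a + s e = 0" using that by (cases "k > 0") simp_all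
  qed
  \<comment> \<open>A solution is either one of the finitely many roots or lies in the cell whose
    lower cut points are \<open>\<sigma>\<close>.\<close>
  have "(\<exists>a. B e a) \<longleftrightarrow> (\<exists>p\<in>E. \<bar>fst p\<bar> dvd snd p e \<and> B e (g (fst p) (snd p) e)) \<or>
      (\<exists>\<sigma>\<in>Pow C. (\<forall>p\<in>L \<sigma>. \<forall>q\<in>U \<sigma>. p e < q e) \<and> T \<sigma> e)" (is "_ \<longleftrightarrow> ?X \<or> ?Y") for e
  proof (intro iffI; (elim disjE)?)
    assume "\<exists>a. B e a"
    then obtain a where a: "B e a" by blast
    show "?X \<or> ?Y"
    proof (cases "\<forall>(k, s)\<in>E. k * a + s e \<noteq> 0")
      case True
      define \<sigma> where "\<sigma> = {p\<in>C. p e < fr a}"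
      have "T \<sigma> e" and ne: "\<forall>p\<in>C. fr a \<noteq> p e" using B[OF True] a by (auto simp: \<sigma>_def)
      have "p e \<le> fr a" if "p \<in> L \<sigma>" for p using that fr_bounds[of a] by (auto simp: L_def \<sigma>_def)
      moreover have "fr a < q e" if "q \<in> U \<sigma>" for q
        using that fr_bounds[of a] ne by (force simp: U_def \<sigma>_def)
      ultimately have "\<forall>p\<in>L \<sigma>. \<forall>q\<in>U \<sigma>. p e < q e" by fastforce
      with \<open>T \<sigma> e\<close> have ?Y by (intro bexI[of _ \<sigma>]) (auto simp: \<sigma>_def)
      then show ?thesis ..
    next
      case False
      then obtain k s where "(k, s) \<in> E" "k * a + s e = 0" by auto
      then have ?X using root[of k a s e] E[of k s] a by (intro bexI[of _ "(k, s)"]) auto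
      then show ?thesis ..
    qed
  next
    assume ?Y
    then obtain \<sigma> where \<sigma>: "\<sigma> \<subseteq> C" "\<forall>p\<in>L \<sigma>. \<forall>q\<in>U \<sigma>. p e < q e" "T \<sigma> e" by blast
    have finLU: "finite (L \<sigma>)" "finite (U \<sigma>)" using fin \<sigma>(1) finite_subset by (auto simp: L_def U_def)
    \<comment> \<open>The greatest lower and the least upper bound span an open interval, in which
      density yields a point other than the roots.\<close>
    define x y where "x = Max ((\<lambda>p. p e) ` L \<sigma>)" and "y = Min ((\<lambda>p. p e) ` U \<sigma>)"
    have "x \<in> (\<lambda>p. p e) ` L \<sigma>" "y \<in> (\<lambda>p. p e) ` U \<sigma>"
      unfolding x_def y_def using finLU by (intro Max_in Min_in; simp add: L_def U_def)+
    then have "x < y" using \<sigma>(2) by auto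
    moreover have x: "p e \<le> x" if "p \<in> L \<sigma>" for p unfolding x_def using finLU that by simp
    moreover have y: "y \<le> p e" if "p \<in> U \<sigma>" for p unfolding y_def using finLU that by simp
    moreover have "0 \<le> x" "y \<le> 1"
      using x[of "\<lambda>_. of_int 0"] y[of "\<lambda>_. of_int 1"] by (auto simp: L_def U_def)
    ultimately obtain a where a: "a \<notin> (\<lambda>(k, s). g k s e) ` E" "x < fr a" "fr a < y"
      using fr_dense_avoiding[of x y "(\<lambda>(k, s). g k s e) ` E"] fin by blast
    have "\<forall>(k, s)\<in>E. k * a + s e \<noteq> 0" using a(1) root E by fastforce
    moreover have "{p\<in>C. p e < fr a} = \<sigma>"
    proof -
      have "p e < fr a" if "p \<in> \<sigma>" for p using x[of p] that a by (simp add: L_def)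
      moreover have "fr a < p e" if "p \<in> C - \<sigma>" for p using y[of p] that a by (simp add: U_def)
      ultimately show ?thesis using \<sigma>(1) by fastforce
    qed
    ultimately have "B e a" using B \<sigma>(3) by auto
    then show "\<exists>a. B e a" ..
  qed blast
  moreover have "definable V (\<lambda>e. (\<exists>p\<in>E. \<bar>fst p\<bar> dvd snd p e \<and> B e (g (fst p) (snd p) e)) \<or>
      (\<exists>\<sigma>\<in>Pow C. (\<forall>p\<in>L \<sigma>. \<forall>q\<in>U \<sigma>. p e < q e) \<and> T \<sigma> e))"
  proof (intro definable_or definable_bex definable_and definable_ball T)
    fix p assume "p \<in> E"
    then have p: "fst p \<noteq> 0" "pw_linear V (snd p)" using E[of "fst p" "snd p"] by auto
    then show "definable V (\<lambda>e. \<bar>fst p\<bar> dvd snd p e)" by (intro definable_pw_linear_dvd) auto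
    show "definable V (\<lambda>e. B e (g (fst p) (snd p) e))"
      using p unfolding g_def by (intro definable_bool_comb_subst[OF assms] pw_linear_div pw_linear_mult) auto
  next
    fix \<sigma> p q assume "\<sigma> \<in> Pow C" "p \<in> L \<sigma>" "q \<in> U \<sigma>"
    then have "cut V p" "cut V q" using cut cut_const[of V 0] cut_const[of V 1] by (auto simp: L_def U_def)
    then show "definable V (\<lambda>e. p e < q e)" by (rule definable_cut_less)
  qed (use fin finite_subset in \<open>auto simp: L_def U_def\<close>)
  ultimately show ?thesis by simp
qed

section \<open>From formulas to Boolean combinations of atoms\<close>

lemma term_value_upd:
  assumes "term_vars u \<subseteq> W"
  shows "\<exists>k t. lin (W - {x}) t \<and> (\<forall>e a. term_value M (e(x := a)) u = k * a + t e)"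
  using assms
proof (induction u)
  case (Var y)
  show ?case
  proof (cases "y = x")
    case True
    then show ?thesis using lin_const[of "W - {x}" 0] by (intro exI[of _ 1] exI[of _ "\<lambda>_. 0"]) auto
  next
    case False
    then show ?thesis using Var lin_term[of "Var y" "W - {x}"]
      by (intro exI[of _ 0] exI[of _ "\<lambda>e. e y"]) auto
  qed
next
  case (Add u v)
  then have W: "term_vars u \<subseteq> W" "term_vars v \<subseteq> W" by simp_all
  obtain k t where "lin (W - {x}) t" "\<forall>e a. term_value M (e(x := a)) u = k * a + t e"
    using Add.IH(1)[OF W(1)] by blast
  moreover obtain k' t' where "lin (W - {x}) t'" "\<forall>e a. term_value M (e(x := a)) v = k' * a + t' e"
    using Add.IH(2)[OF W(2)] by blast
  ultimately show ?case
    by (intro exI[of _ "k + k'"] exI[of _ "\<lambda>e. t e + t' e"] conjI allI lin_add)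
      (simp_all only: term_value.simps structure_simps distrib_right add.assoc add.left_commute)
next
  case (Minus u)
  then have "term_vars u \<subseteq> W" by simp
  then obtain k t where "lin (W - {x}) t" "\<forall>e a. term_value M (e(x := a)) u = k * a + t e"
    using Minus.IH by blast
  then show ?case
    by (intro exI[of _ "- k"] exI[of _ "\<lambda>e. - t e"] conjI allI lin_minus)
      (simp_all only: term_value.simps structure_simps minus_add_distrib minus_mult_left)
next
  case Zero
  show ?case using lin_const[of "W - {x}" 0] by (intro exI[of _ 0] exI[of _ "\<lambda>_. 0"]) auto
next
  case One
  show ?case using lin_const[of "W - {x}" 1] by (intro exI[of _ 0] exI[of _ "\<lambda>_. 1"]) auto
qed

text \<open>After splitting \<open>x\<close> into residue classes \<open>c + N * a\<close>, divisibility by \<open>m\<close> (for \<open>m dvd N\<close>)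
  no longer involves \<open>a\<close>.\<close>

lemma bool_comb_atom:
  assumes "pw_linear V s" "m > 0" "m dvd N"
  shows "bool_comb V (\<lambda>e a. m dvd k * (c + N * a) + s e)"
    and "bool_comb V (\<lambda>e a. (k * (c + N * a) + s e) div m \<in> beatty_set r)"
proof -
  obtain n where N: "N = m * n" using assms(3) by blast
  have g: "pw_linear V (\<lambda>e. k * c + s e)" using assms pw_linear_const pw_linear_add by auto
  have eq: "k * (c + N * a) + s e = m * (k * n * a) + (k * c + s e)" for a e
    by (simp add: N algebra_simps)
  have "m dvd k * (c + N * a) + s e \<longleftrightarrow> m dvd k * c + s e" for a e
    unfolding eq by (metis dvd_add_right_iff dvd_triv_left)
  then show "bool_comb V (\<lambda>e a. m dvd k * (c + N * a) + s e)"
    using bool_comb_param[OF definable_pw_linear_dvd[OF g assms(2)]] by simp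
  have "(k * (c + N * a) + s e) div m = k * n * a + (k * c + s e) div m" for a e
    unfolding eq using assms(2) by simp
  then show "bool_comb V (\<lambda>e a. (k * (c + N * a) + s e) div m \<in> beatty_set r)"
    using bool_comb_beatty[OF pw_linear_div[OF g assms(2)], of "k * n"] by simp
qed

text \<open>One modulus must serve all atoms. Each atom tolerates every multiple of its own index,
  so the claim is made for all multiples of \<open>N0\<close>, and the moduli of two subformulas are
  multiplied.\<close>

lemma formula_bool_comb:
  assumes "quantifier_free \<phi>" "free_vars \<phi> \<subseteq> W"
  shows "\<exists>N0>0. \<forall>N c. N0 dvd N \<longrightarrow> bool_comb (W - {x}) (\<lambda>e a. satisfies M (e(x := c + N * a)) \<phi>)"
  using assms
proof (induction \<phi>)
  case (Eq u v)
  then have W: "term_vars u \<subseteq> W" "term_vars v \<subseteq> W" by simp_all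
  obtain k t where kt: "lin (W - {x}) t" "\<And>e a. term_value M (e(x := a)) u = k * a + t e"
    using term_value_upd[OF W(1)] by blast
  obtain k' t' where kt': "lin (W - {x}) t'" "\<And>e a. term_value M (e(x := a)) v = k' * a + t' e"
    using term_value_upd[OF W(2)] by blast
  have "bool_comb (W - {x}) (\<lambda>e a. satisfies M (e(x := c + N * a)) (Eq u v))" for N c
  proof -
    have "bool_comb (W - {x}) (\<lambda>e a. (k - k') * N * a + ((k - k') * c + (t e + - t' e)) = 0)"
      by (intro bool_comb_eq pw_linear_lin lin_add lin_minus lin_const kt kt')
    moreover have "satisfies M (e(x := c + N * a)) (Eq u v) \<longleftrightarrow>
        (k - k') * N * a + ((k - k') * c + (t e + - t' e)) = 0" for e a
      unfolding satisfies.simps kt kt' by (auto simp: algebra_simps)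
    ultimately show ?thesis by (simp only:)
  qed
  then show ?case using zero_less_one by blast
next
  case (DPlus j u)
  then have "term_vars u \<subseteq> W" by simp
  then obtain k t where kt: "lin (W - {x}) t" "\<And>e a. term_value M (e(x := a)) u = k * a + t e"
    using term_value_upd by blast
  define m where "m = int (j + 1)"
  have "m > 0" by (simp add: m_def)
  have "satisfies M (e(x := b)) (DPlus j u) \<longleftrightarrow> m dvd k * b + t e \<and> (k * b + t e) div m \<in> beatty_set r" for e b
    unfolding satisfies.simps kt structure_simps m_def by (rule D_plus_iff) simp
  then have "bool_comb (W - {x}) (\<lambda>e a. satisfies M (e(x := c + N * a)) (DPlus j u))" if "m dvd N" for N c
    using that \<open>m > 0\<close> kt(1) by (simp only:) (intro bool_comb_and bool_comb_atom pw_linear_lin)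
  with \<open>m > 0\<close> show ?case by blast
next
  case (DMinus j u)
  then have "term_vars u \<subseteq> W" by simp
  then obtain k t where kt: "lin (W - {x}) t" "\<And>e a. term_value M (e(x := a)) u = k * a + t e"
    using term_value_upd by blast
  define m where "m = int (j + 1)"
  have "m > 0" by (simp add: m_def)
  have "satisfies M (e(x := b)) (DMinus j u) \<longleftrightarrow> m dvd k * b + t e \<and> \<not> (k * b + t e) div m \<in> beatty_set r" for e b
    unfolding satisfies.simps kt structure_simps m_def by (rule D_minus_iff) simp
  then have "bool_comb (W - {x}) (\<lambda>e a. satisfies M (e(x := c + N * a)) (DMinus j u))" if "m dvd N" for N c
    using that \<open>m > 0\<close> kt(1) by (simp only:) (intro bool_comb_and bool_comb_not bool_comb_atom pw_linear_lin)
  with \<open>m > 0\<close> show ?case by blast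
next
  case (Neg \<phi>)
  then have "quantifier_free \<phi>" "free_vars \<phi> \<subseteq> W" by simp_all
  from Neg.IH[OF this] show ?case unfolding satisfies.simps using bool_comb_not by blast
next
  case (Conj \<phi> \<psi>)
  then have qf: "quantifier_free \<phi>" "free_vars \<phi> \<subseteq> W" "quantifier_free \<psi>" "free_vars \<psi> \<subseteq> W" by simp_all
  obtain N1 where N1: "N1 > 0" "\<And>N c. N1 dvd N \<Longrightarrow> bool_comb (W - {x}) (\<lambda>e a. satisfies M (e(x := c + N * a)) \<phi>)"
    using Conj.IH(1)[OF qf(1,2)] by blast
  obtain N2 where N2: "N2 > 0" "\<And>N c. N2 dvd N \<Longrightarrow> bool_comb (W - {x}) (\<lambda>e a. satisfies M (e(x := c + N * a)) \<psi>)"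
    using Conj.IH(2)[OF qf(3,4)] by blast
  have "bool_comb (W - {x}) (\<lambda>e a. satisfies M (e(x := c + N * a)) (Conj \<phi> \<psi>))" if "N1 * N2 dvd N" for N c
    unfolding satisfies.simps using that by (intro bool_comb_and N1(2) N2(2)) (blast dest: dvd_mult_left dvd_mult_right)+
  moreover have "N1 * N2 > 0" using N1(1) N2(1) by simp
  ultimately show ?case by blast
next
  case (Disj \<phi> \<psi>)
  then have qf: "quantifier_free \<phi>" "free_vars \<phi> \<subseteq> W" "quantifier_free \<psi>" "free_vars \<psi> \<subseteq> W" by simp_all
  obtain N1 where N1: "N1 > 0" "\<And>N c. N1 dvd N \<Longrightarrow> bool_comb (W - {x}) (\<lambda>e a. satisfies M (e(x := c + N * a)) \<phi>)"
    using Disj.IH(1)[OF qf(1,2)] by blast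
  obtain N2 where N2: "N2 > 0" "\<And>N c. N2 dvd N \<Longrightarrow> bool_comb (W - {x}) (\<lambda>e a. satisfies M (e(x := c + N * a)) \<psi>)"
    using Disj.IH(2)[OF qf(3,4)] by blast
  have "bool_comb (W - {x}) (\<lambda>e a. satisfies M (e(x := c + N * a)) (Disj \<phi> \<psi>))" if "N1 * N2 dvd N" for N c
    unfolding satisfies.simps using that by (intro bool_comb_or N1(2) N2(2)) (blast dest: dvd_mult_left dvd_mult_right)+
  moreover have "N1 * N2 > 0" using N1(1) N2(1) by simp
  ultimately show ?case by blast
qed simp_all

text \<open>Every integer is \<open>c + N * a\<close> with \<open>0 \<le> c < N\<close>, so the
  quantifier becomes a finite disjunction over \<open>c\<close> of quantifiers over
  \<open>a\<close>.\<close>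

lemma definable_Ex:
  assumes "definable W (\<lambda>e. satisfies M e \<phi>)"
  shows "definable (W - {x}) (\<lambda>e. \<exists>a. satisfies M (e(x := a)) \<phi>)"
proof -
  obtain \<psi> where \<psi>: "quantifier_free \<psi>" "free_vars \<psi> \<subseteq> W" "\<And>e. satisfies M e \<phi> \<longleftrightarrow> satisfies M e \<psi>"
    using assms by (auto simp: definable_def)
  obtain N where "N > 0"
    and N: "\<forall>N' c. N dvd N' \<longrightarrow> bool_comb (W - {x}) (\<lambda>e a. satisfies M (e(x := c + N' * a)) \<psi>)"
    using formula_bool_comb[OF \<psi>(1,2), of x] by (elim exE conjE)
  have bool_comb: "bool_comb (W - {x}) (\<lambda>e a. satisfies M (e(x := c + N * a)) \<psi>)" for c
    by (rule N[rule_format, OF dvd_refl])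
  have "(\<exists>a. satisfies M (e(x := a)) \<phi>) \<longleftrightarrow> (\<exists>c\<in>{0..<N}. \<exists>a. satisfies M (e(x := c + N * a)) \<psi>)" for e
  proof
    assume "\<exists>a. satisfies M (e(x := a)) \<phi>"
    then obtain a where "satisfies M (e(x := a)) \<psi>" by (auto simp: \<psi>)
    then have "satisfies M (e(x := a mod N + N * (a div N))) \<psi>" by simp
    moreover have "a mod N \<in> {0..<N}" using \<open>N > 0\<close> by simp
    ultimately show "\<exists>c\<in>{0..<N}. \<exists>a. satisfies M (e(x := c + N * a)) \<psi>" by blast
  qed (auto simp: \<psi>)
  then show ?thesis by (simp only:) (rule definable_bex[OF finite_atLeastLessThan_int definable_bool_comb_ex[OF bool_comb]])
qed

text \<open>Quantifiers are removed from the inside out; a universal one is a negated existential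
  one.\<close>

lemma definable_satisfies: "definable (free_vars \<phi>) (\<lambda>e. satisfies M e \<phi>)"
proof (induction \<phi>)
  case (Conj \<phi> \<psi>)
  have "definable (free_vars (Conj \<phi> \<psi>)) (\<lambda>e. satisfies M e \<phi>)" "definable (free_vars (Conj \<phi> \<psi>)) (\<lambda>e. satisfies M e \<psi>)"
    using Conj unfolding definable_def by fastforce+
  then show ?case by (simp add: definable_and)
next
  case (Disj \<phi> \<psi>)
  have "definable (free_vars (Disj \<phi> \<psi>)) (\<lambda>e. satisfies M e \<phi>)" "definable (free_vars (Disj \<phi> \<psi>)) (\<lambda>e. satisfies M e \<psi>)"
    using Disj unfolding definable_def by fastforce+
  then show ?case by (simp add: definable_or)
next
  case (Neg \<phi>)
  then show ?case by (simp add: definable_not)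
next
  case (Ex x \<phi>)
  then show ?case using definable_Ex[of "free_vars \<phi>" \<phi> x] by simp
next
  case (All x \<phi>)
  have "definable (free_vars \<phi>) (\<lambda>e. satisfies M e (Neg \<phi>))" using definable_not[OF All] by simp
  from definable_not[OF definable_Ex[OF this, of x]] show ?case by simp
qed (rule definable_formula; simp)+

end

theorem theorem1p2:
  fixes r :: real
  assumes "r > 1" and "r \<notin> \<rat>"
  shows "has_quantifier_elimination (beatty_structure r)"
proof -
  interpret irrational_slope r using assms by unfold_locales
  show ?thesis using definable_satisfies unfolding has_quantifier_elimination_def definable_def by blast
qed

end
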